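(* Let $G$ be a connected graph of order at least two and let $H$ be any graph with exactly $i_{H}$ isolated vertices. Then $$\chi_{i}(G\circ H)\leq \chi_{2}(G)|V(H)|-i_{H}\big(\chi_{2}(G)-\chi_{i}(G)\big).$$ Moreover, if $H$ has no isolated vertices, then $$\chi_{i}(G\circ H)=\chi_{2}(G\circ H)\geq(\Delta(G)+1)|V(H)|.$$
   Context: All graphs are finite and simple. An injective $k$-coloring of a graph $G$ is a function $f:V(G)\to\{1,\dots,k\}$ such that no vertex is adjacent to two distinct vertices $u,w$ with $f(u)=f(w)$; $\chi_i(G)$, the injective chromatic number, is the minimum such $k$. A 2-distance coloring of $G$ assigns colors to vertices so that any two distinct vertices at distance at most two receive different colors; $\chi_2(G)$ is the minimum number of colors in such a coloring. $\Delta(G)$ is the maximum degree. The lexicographic product $G\circ H$ has vertex set $V(G)\times V(H)$, with $(g,h)$ and $(g',h')$ adjacent iff $gg'\in E(G)$, or $g=g'$ and $hh'\in E(H)$. *)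

theory Defs
  imports "Graph_Theory.Graph_Theory"
begin

text \<open>Finite simple graphs are the \<^locale>\<open>pair_graph\<close>s of the library: an undirected edge
  is the pair of arcs (u, v), (v, u). In such a graph the out-degree is the degree.\<close>

definition max_degree :: "'a pair_pre_digraph \<Rightarrow> nat" where
  "max_degree G = Max (out_degree (with_proj G) ` pverts G)"

definition isolated_verts :: "'a pair_pre_digraph \<Rightarrow> 'a set" where
  "isolated_verts G = {v \<in> pverts G. \<forall>u \<in> pverts G. \<not> v \<rightarrow>\<^bsub>with_proj G\<^esub> u}"

definition lex_product ::
  "'a pair_pre_digraph \<Rightarrow> 'b pair_pre_digraph \<Rightarrow> ('a \<times> 'b) pair_pre_digraph" where
  "lex_product G H =
    \<lparr> pverts = pverts G \<times> pverts H,
      parcs = {((g, h), (g', h')) | g h g' h'.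
        g \<in> pverts G \<and> g' \<in> pverts G \<and> h \<in> pverts H \<and> h' \<in> pverts H \<and>
        (g \<rightarrow>\<^bsub>with_proj G\<^esub> g' \<or> g = g' \<and> h \<rightarrow>\<^bsub>with_proj H\<^esub> h')} \<rparr>"

lemma pair_graph_lex_product:
  assumes "pair_graph G" "pair_graph H"
  shows "pair_graph (lex_product G H)"
proof -
  interpret G: pair_graph G by fact
  interpret H: pair_graph H by fact
  have sub: "parcs (lex_product G H) \<subseteq> (pverts G \<times> pverts H) \<times> (pverts G \<times> pverts H)"
    by (auto simp: lex_product_def)
  have fin: "finite (pverts (lex_product G H))"
    by (simp add: lex_product_def G.pair_finite_verts H.pair_finite_verts)
  have "(v, u) \<in> parcs (lex_product G H)" if "(u, v) \<in> parcs (lex_product G H)" for u v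
    using that G.arcs_symmetric H.arcs_symmetric by (auto simp: lex_product_def)
  moreover have "fst e \<noteq> snd e" if "e \<in> parcs (lex_product G H)" for e
    using that by (auto simp: lex_product_def dest: G.pair_no_loops H.pair_no_loops)
  moreover have "finite (parcs (lex_product G H))"
    by (rule finite_subset[OF sub]) (simp add: G.pair_finite_verts H.pair_finite_verts)
  ultimately show ?thesis
    using fin by unfold_locales (auto simp: symmetric_def sym_def lex_product_def)
qed

definition injective_coloring :: "'a pair_pre_digraph \<Rightarrow> nat \<Rightarrow> ('a \<Rightarrow> nat) \<Rightarrow> bool" where
  "injective_coloring G k f \<longleftrightarrow> f \<in> pverts G \<rightarrow> {1..k} \<and>
    (\<forall>v \<in> pverts G. \<not> (\<exists>u \<in> pverts G. \<exists>w \<in> pverts G. u \<noteq> w \<and>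
      v \<rightarrow>\<^bsub>with_proj G\<^esub> u \<and> v \<rightarrow>\<^bsub>with_proj G\<^esub> w \<and> f u = f w))"

definition injective_chromatic_number :: "'a pair_pre_digraph \<Rightarrow> nat" where
  "injective_chromatic_number G = (LEAST k. \<exists>f. injective_coloring G k f)"

text \<open>\<^const>\<open>wf_digraph.\<mu>\<close> is the infimum of the costs of the walks between two vertices; with
  unit weights it is the distance, which is infinite for vertices in different components.\<close>

definition graph_dist :: "'a pair_pre_digraph \<Rightarrow> 'a \<Rightarrow> 'a \<Rightarrow> ereal" where
  "graph_dist G u v = wf_digraph.\<mu> (with_proj G) (\<lambda>_. 1) u v"

definition two_distance_coloring :: "'a pair_pre_digraph \<Rightarrow> nat \<Rightarrow> ('a \<Rightarrow> nat) \<Rightarrow> bool" where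
  "two_distance_coloring G k f \<longleftrightarrow> f \<in> pverts G \<rightarrow> {1..k} \<and>
    (\<forall>u \<in> pverts G. \<forall>v \<in> pverts G. u \<noteq> v \<and> graph_dist G u v \<le> 2 \<longrightarrow> f u \<noteq> f v)"

definition two_distance_chromatic_number :: "'a pair_pre_digraph \<Rightarrow> nat" where
  "two_distance_chromatic_number G = (LEAST k. \<exists>f. two_distance_coloring G k f)"

end

theory Submission
  imports Defs
begin

text \<open>For the upper bound, take a 2-distance coloring $c_2$ and an injective coloring $c_i$ of $G$,
  and color $(g, h)$ by $(c_i(g), h)$ if $h$ is isolated in $H$ and by $(c_2(g), h)$ otherwise: a common
  neighbor of $(g, h)$ and $(g', h)$ with $h$ isolated projects to a common neighbor of $g$ and $g'$.
  If $H$ has no isolated vertices, then any two adjacent vertices of $G \circ H$ have a common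
  neighbor, so injective and 2-distance colorings coincide; and for a vertex $v$ of maximum degree
  the vertices of $N[v] \times V(H)$ are pairwise at distance at most two.\<close>

section \<open>Distance at most two, and both colorings in terms of arcs\<close>

context pair_graph
begin

text \<open>With unit weights the cost of a walk is its length, so the distance is at most two
  exactly when some walk with at most two arcs exists, and such walks can be listed by
  length.\<close>

lemma graph_dist_le_two_iff:
  assumes "u \<in> pverts G" "v \<in> pverts G"
  shows "graph_dist G u v \<le> 2 \<longleftrightarrow>
    u = v \<or> (u, v) \<in> parcs G \<or> (\<exists>w. (u, w) \<in> parcs G \<and> (w, v) \<in> parcs G)"
proof -
  have cost: "awalk_cost (\<lambda>_. 1) p = real (length p)" for p :: "('a \<times> 'a) list"
    by (induction p) simp_all
  have "graph_dist G u v \<le> 2 \<longleftrightarrow> (\<exists>p. awalk u p v \<and> length p \<le> 2)"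
  proof
    assume "graph_dist G u v \<le> 2"
    \<comment> \<open>An infimum yields a walk only from a strict bound. The bound 3 does no harm:
      lengths are integers, so below 3 means at most 2.\<close>
    moreover have "(2 :: ereal) < ereal 3" by simp
    ultimately have "graph_dist G u v < ereal 3"
      by (rule order.strict_trans1)
    then obtain p where "awalk u p v" "ereal (awalk_cost (\<lambda>_. 1) p) < ereal 3"
      unfolding graph_dist_def \<mu>_def INF_less_iff by blast
    moreover from this have "length p \<le> 2"
      by (simp add: cost)
    ultimately show "\<exists>p. awalk u p v \<and> length p \<le> 2" by blast
  next
    assume "\<exists>p. awalk u p v \<and> length p \<le> 2"
    then obtain p where p: "awalk u p v" "length p \<le> 2" by blast
    have "graph_dist G u v \<le> ereal (real (length p))"
      using min_cost_le_walk_cost[OF p(1), of "\<lambda>_. 1"] by (simp add: graph_dist_def cost)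
    also have "\<dots> \<le> 2" using p(2) by simp
    finally show "graph_dist G u v \<le> 2" .
  qed
  also have "\<dots> \<longleftrightarrow> u = v \<or> (u, v) \<in> parcs G \<or> (\<exists>w. (u, w) \<in> parcs G \<and> (w, v) \<in> parcs G)"
    (is "_ \<longleftrightarrow> ?R")
  proof
    assume "\<exists>p. awalk u p v \<and> length p \<le> 2"
    then obtain p where p: "awalk u p v" "length p \<le> 2" by blast
    then consider "p = []" | e where "p = [e]" | e e' where "p = [e, e']"
      by (auto simp: le_Suc_eq length_Suc_conv numeral_2_eq_2)
    then show ?R
      using p(1) by cases (auto simp: awalk_simps)
  next
    assume ?R
    then consider "u = v" | "(u, v) \<in> parcs G"
      | w where "(u, w) \<in> parcs G" "(w, v) \<in> parcs G" by blast
    then show "\<exists>p. awalk u p v \<and> length p \<le> 2"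
    proof cases
      case 1
      then show ?thesis using assms by (intro exI[of _ "[]"]) (simp add: awalk_simps)
    next
      case 2
      then show ?thesis using assms by (intro exI[of _ "[(u, v)]"]) (simp add: awalk_simps)
    next
      case (3 w)
      then show ?thesis
        using assms by (intro exI[of _ "[(u, w), (w, v)]"]) (simp add: awalk_simps)
    qed
  qed
  finally show ?thesis .
qed

lemma two_distance_coloring_iff:
  "two_distance_coloring G k f \<longleftrightarrow> f \<in> pverts G \<rightarrow> {1..k} \<and>
    (\<forall>u \<in> pverts G. \<forall>v \<in> pverts G. u \<noteq> v \<and>
      ((u, v) \<in> parcs G \<or> (\<exists>w. (u, w) \<in> parcs G \<and> (w, v) \<in> parcs G)) \<longrightarrow> f u \<noteq> f v)"
  unfolding two_distance_coloring_def
  by (simp only: graph_dist_le_two_iff cong: ball_cong) blast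

text \<open>Symmetry of the arcs turns two arcs out of a common neighbor \<open>w\<close> into a
  walk from \<open>u\<close> through \<open>w\<close> to \<open>v\<close>. In this form the
  condition differs from that of \<open>two_distance_coloring_iff\<close> only by the disjunct for
  adjacent \<open>u\<close> and \<open>v\<close>.\<close>

lemma injective_coloring_iff:
  "injective_coloring G k f \<longleftrightarrow> f \<in> pverts G \<rightarrow> {1..k} \<and>
    (\<forall>u \<in> pverts G. \<forall>v \<in> pverts G. u \<noteq> v \<and>
      (\<exists>w. (u, w) \<in> parcs G \<and> (w, v) \<in> parcs G) \<longrightarrow> f u \<noteq> f v)"
proof -
  have "(\<exists>x \<in> pverts G. (x, u) \<in> parcs G \<and> (x, v) \<in> parcs G) \<longleftrightarrow>
      (\<exists>w. (u, w) \<in> parcs G \<and> (w, v) \<in> parcs G)" for u v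
    using arcs_symmetric in_arcsD1 by (metis with_proj_simps(1,2,4))
  moreover have "(\<forall>x \<in> pverts G. \<not> (\<exists>u \<in> pverts G. \<exists>v \<in> pverts G. u \<noteq> v \<and>
        (x, u) \<in> parcs G \<and> (x, v) \<in> parcs G \<and> f u = f v)) \<longleftrightarrow>
      (\<forall>u \<in> pverts G. \<forall>v \<in> pverts G. u \<noteq> v \<and>
        (\<exists>x \<in> pverts G. (x, u) \<in> parcs G \<and> (x, v) \<in> parcs G) \<longrightarrow> f u \<noteq> f v)"
    by auto
  ultimately show ?thesis
    unfolding injective_coloring_def by simp
qed

text \<open>Colors may be renamed along a bijection from \<open>C\<close> to
  \<open>{1..card C}\<close>. This permits pairs as colors of a product.\<close>

lemma injective_chromatic_number_le_card:
  assumes "finite C" "f \<in> pverts G \<rightarrow> C"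
    and "\<And>u v w. \<lbrakk>u \<noteq> v; (u, w) \<in> parcs G; (w, v) \<in> parcs G\<rbrakk> \<Longrightarrow> f u \<noteq> f v"
  shows "injective_chromatic_number G \<le> card C"
proof -
  obtain e where e: "bij_betw e C {1..card C}"
    using finite_same_card_bij[OF assms(1), of "{1..card C}"] by auto
  have "injective_coloring G (card C) (e \<circ> f)"
    unfolding injective_coloring_iff
  proof (intro conjI ballI impI)
    show "e \<circ> f \<in> pverts G \<rightarrow> {1..card C}"
      using assms(2) bij_betw_imp_funcset[OF e] by auto
    fix u v
    assume uv: "u \<in> pverts G" "v \<in> pverts G"
      and "u \<noteq> v \<and> (\<exists>w. (u, w) \<in> parcs G \<and> (w, v) \<in> parcs G)"
    then have "f u \<noteq> f v" using assms(3) by blast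
    then show "(e \<circ> f) u \<noteq> (e \<circ> f) v"
      using uv assms(2) inj_onD[OF bij_betw_imp_inj_on[OF e]] by auto
  qed
  then show ?thesis
    unfolding injective_chromatic_number_def by (blast intro: Least_le)
qed

text \<open>\<open>LEAST\<close> is meaningful only once some coloring exists; giving all vertices
  different colors is one.\<close>

lemma two_distance_chromatic_number_attained:
  obtains f where "two_distance_coloring G (two_distance_chromatic_number G) f"
proof -
  obtain e where e: "bij_betw e (pverts G) {1..card (pverts G)}"
    using finite_same_card_bij[OF pair_finite_verts, of "{1..card (pverts G)}"] by auto
  have "two_distance_coloring G (card (pverts G)) e"
    unfolding two_distance_coloring_def
    using bij_betw_imp_funcset[OF e] bij_betw_imp_inj_on[OF e] by (simp add: inj_on_eq_iff)
  then have "\<exists>f. two_distance_coloring G (two_distance_chromatic_number G) f"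
    unfolding two_distance_chromatic_number_def
    by (rule LeastI[where P = "\<lambda>k. \<exists>f. two_distance_coloring G k f", OF exI])
  then show thesis using that by blast
qed

lemma injective_chromatic_number_attained:
  obtains f where "injective_coloring G (injective_chromatic_number G) f"
proof -
  obtain f where "two_distance_coloring G (two_distance_chromatic_number G) f"
    by (rule two_distance_chromatic_number_attained)
  \<comment> \<open>A 2-distance coloring satisfies the weaker injective condition, which shows that
    injective colorings exist.\<close>
  then have "injective_coloring G (two_distance_chromatic_number G) f"
    unfolding two_distance_coloring_iff injective_coloring_iff by simp
  then have "\<exists>f. injective_coloring G (injective_chromatic_number G) f"
    unfolding injective_chromatic_number_def
    by (rule LeastI[where P = "\<lambda>k. \<exists>f. injective_coloring G k f", OF exI])
  then show thesis using that by blast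
qed

section \<open>Neighbors and maximum degree\<close>

lemma connected_imp_ex_neighbor:
  assumes "Digraph_Component.connected (with_proj G)" "card (pverts G) \<ge> 2" "g \<in> pverts G"
  obtains g' where "(g, g') \<in> parcs G"
proof -
  have "\<exists>x. x \<in> pverts G \<and> x \<noteq> g"
  proof (rule ccontr)
    assume "\<nexists>x. x \<in> pverts G \<and> x \<noteq> g"
    then have "pverts G \<subseteq> {g}" by blast
    then have "card (pverts G) \<le> card {g}" by (intro card_mono) auto
    with assms(2) show False by simp
  qed
  then obtain x where x: "x \<in> pverts G" "x \<noteq> g" by blast
  \<comment> \<open>Connectedness is strong connectedness of the symmetric closure; since
    \<open>G\<close> is already symmetric, reachability there is reachability in \<open>G\<close>.
    As \<open>x\<close> differs from \<open>g\<close>, the walk is nonempty and its first arc leads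
    to a neighbor of \<open>g\<close>.\<close>
  have "g \<rightarrow>\<^sup>*\<^bsub>mk_symmetric (with_proj G)\<^esub> x"
    using assms(1,3) x(1) unfolding connected_def strongly_connected_def by simp
  then have "g \<rightarrow>\<^sup>*\<^bsub>with_proj G\<^esub> x"
    using reachable_mk_symmetric_eq[OF sym_arcs] by blast
  then have "(g, x) \<in> (parcs G)\<^sup>+"
    using x(2) reachable_neq_reachable1 by fastforce
  then show thesis
    using that by (auto elim: converse_tranclE)
qed

lemma max_degree_attained:
  assumes "pverts G \<noteq> {}"
  obtains v where "v \<in> pverts G" "card {u. (v, u) \<in> parcs G} = max_degree G"
proof -
  have "max_degree G \<in> out_degree (with_proj G) ` pverts G"
    unfolding max_degree_def using assms by (intro Max_in) auto
  then obtain v where v: "v \<in> pverts G" "out_degree (with_proj G) v = max_degree G"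
    by auto
  have "out_arcs (with_proj G) v = Pair v ` {u. (v, u) \<in> parcs G}"
    by (auto simp: out_arcs_def)
  then have "out_degree (with_proj G) v = card {u. (v, u) \<in> parcs G}"
    by (simp add: out_degree_def card_image inj_on_def)
  with v show thesis using that by simp
qed

end

section \<open>Arcs of the lexicographic product\<close>

lemma pverts_lex_product [simp]: "pverts (lex_product G H) = pverts G \<times> pverts H"
  by (simp add: lex_product_def)

text \<open>Arcs of \<open>G\<close> and \<open>H\<close> have their ends among the vertices, so
  only the vertex conditions not implied by the arc remain.\<close>

lemma parcs_lex_product_iff:
  assumes "pair_graph G" "pair_graph H"
  shows "((g, h), (g', h')) \<in> parcs (lex_product G H) \<longleftrightarrow>
    h \<in> pverts H \<and> h' \<in> pverts H \<and> (g, g') \<in> parcs G \<or>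
    g \<in> pverts G \<and> g = g' \<and> (h, h') \<in> parcs H"
proof -
  interpret G: pair_graph G by fact
  interpret H: pair_graph H by fact
  show ?thesis
    using G.in_arcsD1 G.in_arcsD2 H.in_arcsD1 H.in_arcsD2
    by (auto simp: lex_product_def)
qed

section \<open>Upper bound by a coloring with pairs\<close>

lemma isolated_vertsD:
  assumes "pair_graph H" "h \<in> isolated_verts H"
  shows "(h, x) \<notin> parcs H"
proof -
  interpret H: pair_graph H by fact
  show ?thesis
    using assms(2) H.in_arcsD2 unfolding isolated_verts_def by auto
qed

text \<open>Non-isolated and isolated vertices of \<open>H\<close> are counted separately, with the
  color sets \<open>?A\<close> and \<open>?B\<close>. This keeps subtraction out of the bound on
  natural numbers.\<close>

lemma injective_chromatic_number_lex_product_le: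
  assumes G: "pair_graph G" and H: "pair_graph H"
  shows "injective_chromatic_number (lex_product G H) \<le>
    two_distance_chromatic_number G * card (pverts H - isolated_verts H) +
    injective_chromatic_number G * card (isolated_verts H)"
proof -
  interpret G: pair_graph G by fact
  interpret H: pair_graph H by fact
  interpret L: pair_graph "lex_product G H" by (rule pair_graph_lex_product[OF G H])
  let ?I = "isolated_verts H"
  let ?A = "{1..two_distance_chromatic_number G} \<times> (pverts H - ?I)"
  let ?B = "{1..injective_chromatic_number G} \<times> ?I"
  obtain f2 where f2: "two_distance_coloring G (two_distance_chromatic_number G) f2"
    by (rule G.two_distance_chromatic_number_attained)
  obtain fi where fi: "injective_coloring G (injective_chromatic_number G) fi"
    by (rule G.injective_chromatic_number_attained)
  have I: "?I \<subseteq> pverts H" by (auto simp: isolated_verts_def)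
  then have finI: "finite ?I" using H.pair_finite_verts by (rule finite_subset)
  \<comment> \<open>The second component keeps vertices with different \<open>h\<close> apart, so
    only pairs with equal second coordinate need an argument.\<close>
  define f where "f = (\<lambda>(g, h). (if h \<in> ?I then fi g else f2 g, h))"
  have "injective_chromatic_number (lex_product G H) \<le> card (?A \<union> ?B)"
  proof (rule L.injective_chromatic_number_le_card[of _ f])
    show "finite (?A \<union> ?B)" using finI H.pair_finite_verts by simp
    show "f \<in> pverts (lex_product G H) \<rightarrow> ?A \<union> ?B"
      using f2 fi unfolding G.two_distance_coloring_iff G.injective_coloring_iff f_def
      by (fastforce simp: Pi_iff)
    fix u v w
    assume "u \<noteq> v" and arcs: "(u, w) \<in> parcs (lex_product G H)" "(w, v) \<in> parcs (lex_product G H)"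
    obtain g h g' h' x y where [simp]: "u = (g, h)" "v = (g', h')" "w = (x, y)"
      by (cases u, cases v, cases w)
    have vs: "g \<in> pverts G" "g' \<in> pverts G"
      using L.in_arcsD1[OF arcs(1)] L.in_arcsD2[OF arcs(2)] by auto
    show "f u \<noteq> f v"
    proof (cases "h = h'")
      case True
      with \<open>u \<noteq> v\<close> have "g \<noteq> g'" by simp
      show ?thesis
      proof (cases "h \<in> ?I")
        case True
        \<comment> \<open>Neither arc of the walk can stay in one copy of \<open>H\<close>, because
          \<open>h\<close> is isolated; hence both project to arcs of \<open>G\<close>.\<close>
        then have no: "(h, y) \<notin> parcs H" "(y, h) \<notin> parcs H"
          using isolated_vertsD[OF H] H.arcs_symmetric by blast+
        then have "(g, x) \<in> parcs G" "(x, g') \<in> parcs G"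
          using arcs \<open>h = h'\<close> by (auto simp: parcs_lex_product_iff[OF G H])
        then have "fi g \<noteq> fi g'"
          using fi vs \<open>g \<noteq> g'\<close> unfolding G.injective_coloring_iff by blast
        then show ?thesis using True \<open>h = h'\<close> by (simp add: f_def)
      next
        case False
        \<comment> \<open>At most one of the two arcs stays in a copy of \<open>H\<close>, since
          otherwise \<open>g = x = g'\<close>. The projected walk therefore has one or two
          arcs.\<close>
        have "(g, g') \<in> parcs G \<or> (\<exists>z. (g, z) \<in> parcs G \<and> (z, g') \<in> parcs G)"
          using arcs \<open>g \<noteq> g'\<close> by (auto simp: parcs_lex_product_iff[OF G H])
        then have "f2 g \<noteq> f2 g'"
          using f2 vs \<open>g \<noteq> g'\<close> unfolding G.two_distance_coloring_iff by blast
        then show ?thesis using False \<open>h = h'\<close> by (simp add: f_def)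
      qed
    qed (simp add: f_def)
  qed
  also have "\<dots> \<le> card ?A + card ?B" by (rule card_Un_le)
  finally show ?thesis by (simp add: card_cartesian_product)
qed

section \<open>Common neighbors of adjacent vertices, and the lower bound\<close>

lemma lex_product_arc_imp_common_neighbor:
  assumes G: "pair_graph G" and H: "pair_graph H" and "isolated_verts H = {}"
    and ex: "\<And>g. g \<in> pverts G \<Longrightarrow> \<exists>g'. (g, g') \<in> parcs G"
    and "(u, v) \<in> parcs (lex_product G H)"
  shows "\<exists>w. (u, w) \<in> parcs (lex_product G H) \<and> (w, v) \<in> parcs (lex_product G H)"
proof -
  interpret G: pair_graph G by fact
  interpret H: pair_graph H by fact
  obtain g h g' h' where [simp]: "u = (g, h)" "v = (g', h')"
    by (cases u, cases v)
  consider "h \<in> pverts H" "h' \<in> pverts H" "(g, g') \<in> parcs G"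
    | "g \<in> pverts G" "g = g'" "(h, h') \<in> parcs H"
    using assms(5) by (auto simp: parcs_lex_product_iff[OF G H])
  then show ?thesis
  proof cases
    case 1
    \<comment> \<open>Moving within the copy of \<open>H\<close> over \<open>g\<close> from
      \<open>h\<close> to its neighbor \<open>y\<close> keeps adjacency to \<open>v\<close>, as an
      arc of \<open>G\<close> joins all pairs of vertices above its ends.\<close>
    then obtain y where y: "(h, y) \<in> parcs H"
      using \<open>isolated_verts H = {}\<close> by (auto simp: isolated_verts_def)
    then have "y \<in> pverts H" "g \<in> pverts G" using H.in_arcsD2 G.in_arcsD1 1(3) by auto
    with 1 y have "(u, (g, y)) \<in> parcs (lex_product G H)" "((g, y), v) \<in> parcs (lex_product G H)"
      by (simp_all add: parcs_lex_product_iff[OF G H])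
    then show ?thesis by blast
  next
    case 2
    \<comment> \<open>Both ends lie in the copy of \<open>H\<close> over \<open>g\<close>; every
      vertex over a neighbor \<open>x\<close> of \<open>g\<close> is adjacent to both.\<close>
    then obtain x where x: "(g, x) \<in> parcs G" using ex by blast
    moreover from x have "(x, g) \<in> parcs G" by (rule G.arcs_symmetric)
    moreover have "h \<in> pverts H" "h' \<in> pverts H" using H.in_arcsD1 H.in_arcsD2 2(3) by auto
    ultimately have "(u, (x, h)) \<in> parcs (lex_product G H)" "((x, h), v) \<in> parcs (lex_product G H)"
      using 2 by (simp_all add: parcs_lex_product_iff[OF G H])
    then show ?thesis by blast
  qed
qed

text \<open>For a vertex \<open>v\<close> of maximum degree with closed neighborhood
  \<open>N\<close>, a 2-distance coloring must be injective on
  \<open>N \<times> pverts H\<close>.\<close>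

lemma two_distance_chromatic_number_lex_product_ge:
  assumes G: "pair_graph G" and H: "pair_graph H" and "pverts G \<noteq> {}"
    and ex: "\<And>g. g \<in> pverts G \<Longrightarrow> \<exists>g'. (g, g') \<in> parcs G"
  shows "(max_degree G + 1) * card (pverts H) \<le> two_distance_chromatic_number (lex_product G H)"
proof -
  interpret G: pair_graph G by fact
  interpret H: pair_graph H by fact
  interpret L: pair_graph "lex_product G H" by (rule pair_graph_lex_product[OF G H])
  let ?k = "two_distance_chromatic_number (lex_product G H)"
  obtain v where v: "v \<in> pverts G" "card {u. (v, u) \<in> parcs G} = max_degree G"
    using G.max_degree_attained[OF \<open>pverts G \<noteq> {}\<close>] .
  define N where "N = insert v {u. (v, u) \<in> parcs G}"
  have N: "N \<subseteq> pverts G" using v G.in_arcsD2 by (auto simp: N_def)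
  then have "finite N" using G.pair_finite_verts by (rule finite_subset)
  moreover have "(v, v) \<notin> parcs G" using G.pair_no_loops by fastforce
  ultimately have card_N: "card N = max_degree G + 1"
    using v by (simp add: N_def)
  obtain f where f: "two_distance_coloring (lex_product G H) ?k f"
    by (rule L.two_distance_chromatic_number_attained)
  have "inj_on f (N \<times> pverts H)"
  proof (rule inj_onI, rule ccontr)
    fix a b
    assume ab: "a \<in> N \<times> pverts H" "b \<in> N \<times> pverts H" "f a = f b" "a \<noteq> b"
    obtain g h g' h' where [simp]: "a = (g, h)" "b = (g', h')"
      by (cases a, cases b)
    \<comment> \<open>The neighbor \<open>x\<close> serves the case \<open>g = g' = v\<close>,
      through the closed walk from \<open>v\<close> to \<open>x\<close> and back. Two neighbors of
      \<open>v\<close>, equal or not, are linked through \<open>v\<close> itself.\<close>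
    obtain x where x: "(v, x) \<in> parcs G" using ex v by blast
    have sym: "(q, p) \<in> parcs G" if "(p, q) \<in> parcs G" for p q
      using that by (rule G.arcs_symmetric)
    have "(g, g') \<in> parcs G \<or> (\<exists>z. (g, z) \<in> parcs G \<and> (z, g') \<in> parcs G)"
      using ab(1,2) x sym by (auto simp: N_def)
    \<comment> \<open>Walks of \<open>G\<close> with one or two arcs lift to the product with any
      prescribed end coordinates in \<open>H\<close>; the middle vertex may take any second
      coordinate, for instance \<open>h\<close>.\<close>
    then have "(a, b) \<in> parcs (lex_product G H) \<or>
        (\<exists>w. (a, w) \<in> parcs (lex_product G H) \<and> (w, b) \<in> parcs (lex_product G H))"
      using ab(1,2) by (auto simp: parcs_lex_product_iff[OF G H])
    moreover have "a \<in> pverts (lex_product G H)" "b \<in> pverts (lex_product G H)"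
      using ab(1,2) N by auto
    ultimately have "f a \<noteq> f b"
      using f ab(4) unfolding L.two_distance_coloring_iff by blast
    with ab(3) show False by simp
  qed
  moreover have "f ` (N \<times> pverts H) \<subseteq> {1..?k}"
    using f N unfolding L.two_distance_coloring_iff by auto
  ultimately have "card (N \<times> pverts H) \<le> card {1..?k}"
    by (intro card_inj_on_le) auto
  then show ?thesis by (simp add: card_cartesian_product card_N)
qed

theorem theorem3p1:
  fixes G :: "'a pair_pre_digraph" and H :: "'b pair_pre_digraph" and i_H :: nat
  assumes "pair_graph G" and "Digraph_Component.connected (with_proj G)" and "card (pverts G) \<ge> 2"
    and "pair_graph H" and "card (isolated_verts H) = i_H"
  shows "int (injective_chromatic_number (lex_product G H)) \<le>
      int (two_distance_chromatic_number G) * int (card (pverts H))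
      - int i_H * (int (two_distance_chromatic_number G) - int (injective_chromatic_number G))
    \<and> (isolated_verts H = {} \<longrightarrow>
        injective_chromatic_number (lex_product G H) = two_distance_chromatic_number (lex_product G H) \<and>
        two_distance_chromatic_number (lex_product G H) \<ge> (max_degree G + 1) * card (pverts H))"
proof -
  interpret G: pair_graph G by fact
  interpret H: pair_graph H by fact
  interpret L: pair_graph "lex_product G H"
    by (rule pair_graph_lex_product[OF assms(1,4)])
  have ex: "\<exists>g'. (g, g') \<in> parcs G" if "g \<in> pverts G" for g
    using G.connected_imp_ex_neighbor[OF assms(2,3) that] by blast
  have I: "isolated_verts H \<subseteq> pverts H" by (auto simp: isolated_verts_def)
  have "card (pverts H - isolated_verts H) = card (pverts H) - i_H" "i_H \<le> card (pverts H)"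
    using I assms(5) H.pair_finite_verts
    by (auto simp: card_Diff_subset finite_subset intro: card_mono)
  \<comment> \<open>The bound on \<open>i_H\<close> ensures that the natural subtraction does not
    truncate.\<close>
  then have "int (card (pverts H - isolated_verts H)) = int (card (pverts H)) - int i_H"
    by simp
  moreover have "int (injective_chromatic_number (lex_product G H)) \<le>
      int (two_distance_chromatic_number G) * int (card (pverts H - isolated_verts H)) +
      int (injective_chromatic_number G) * int i_H"
    using injective_chromatic_number_lex_product_le[OF assms(1,4)]
    unfolding assms(5) of_nat_mult[symmetric] of_nat_add[symmetric] of_nat_le_iff .
  ultimately have "int (injective_chromatic_number (lex_product G H)) \<le>
      int (two_distance_chromatic_number G) * (int (card (pverts H)) - int i_H) +
      int (injective_chromatic_number G) * int i_H"
    by simp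
  then have upper: "int (injective_chromatic_number (lex_product G H)) \<le>
      int (two_distance_chromatic_number G) * int (card (pverts H))
      - int i_H * (int (two_distance_chromatic_number G) - int (injective_chromatic_number G))"
    by (simp add: algebra_simps)
  have "injective_chromatic_number (lex_product G H) = two_distance_chromatic_number (lex_product G H)"
    if "isolated_verts H = {}"
  proof -
    \<comment> \<open>Adjacent vertices have a common neighbor, so the disjunct for adjacency is
      absorbed. The two minima then range over the same set of \<open>k\<close>.\<close>
    have "injective_coloring (lex_product G H) k f \<longleftrightarrow> two_distance_coloring (lex_product G H) k f"
      for k f
      using lex_product_arc_imp_common_neighbor[OF assms(1,4) that ex]
      unfolding L.two_distance_coloring_iff L.injective_coloring_iff by blast
    then show ?thesis
      by (simp add: injective_chromatic_number_def two_distance_chromatic_number_def)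
  qed
  moreover have "pverts G \<noteq> {}" using assms(3) by auto
  ultimately show ?thesis
    using upper two_distance_chromatic_number_lex_product_ge[OF assms(1,4) _ ex] by blast
qed

end
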